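(* Let $n\ge 1$ be an integer and let $U$ be a (rational) spectral unit of size $n$ with finite order. If $n$ is even, then every eigenvalue $\xi$ of $U$ satisfies $\xi^n=1$. If $n$ is odd, then every eigenvalue $\xi$ of $U$ is either an $n$-th root of unity or the opposite of an $n$-th root of unity (i.e. $\xi^{2n}=1$).
   Context: A matrix $M\in\mathcal M_n(\mathbb C)$, with rows and columns indexed by $\mathbb Z_n=\mathbb Z/n\mathbb Z$, is circulating (circulant) if there is a vector $(\alpha_0,\dots,\alpha_{n-1})$ such that its general coefficient is $m_{i,j}=\alpha_{i-j}$, the index $i-j$ being computed modulo $n$. A (rational) spectral unit of size $n$ is a circulating $n\times n$ matrix $U$ with entries in $\mathbb Q$ which is unitary: ${}^t\overline U=U^{-1}$. It has finite order if $U^m=I_n$ for some integer $m\ge 1$. *)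

theory Defs
  imports "Jordan_Normal_Form.Char_Poly" "Jordan_Normal_Form.Schur_Decomposition"
begin

text \<open>Rows and columns are indexed by the representatives \<open>0, \<dots>, n - 1\<close> of \<open>\<int>/n\<int>\<close>. The index
  \<open>i - j\<close> is reduced modulo \<open>n\<close> on \<open>int\<close>, since subtraction on \<open>nat\<close> truncates.\<close>

definition circulant_mat :: "nat \<Rightarrow> 'a mat \<Rightarrow> bool" where
  "circulant_mat n M \<longleftrightarrow>
     M \<in> carrier_mat n n \<and>
     (\<exists>\<alpha> \<in> carrier_vec n. \<forall>i<n. \<forall>j<n.
        M $$ (i, j) = \<alpha> $ nat ((int i - int j) mod int n))"

text \<open>\<open>mat_adjoint\<close> is the conjugate transpose.\<close>

definition unitary_mat :: "complex mat \<Rightarrow> bool" where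
  "unitary_mat U \<longleftrightarrow>
     square_mat U \<and> inverts_mat U (mat_adjoint U) \<and> inverts_mat (mat_adjoint U) U"

definition spectral_unit :: "nat \<Rightarrow> complex mat \<Rightarrow> bool" where
  "spectral_unit n U \<longleftrightarrow> circulant_mat n U \<and> elements_mat U \<subseteq> \<rat> \<and> unitary_mat U"

definition finite_order_mat :: "'a :: semiring_1 mat \<Rightarrow> bool" where
  "finite_order_mat U \<longleftrightarrow> (\<exists>m\<ge>1. U ^\<^sub>m m = 1\<^sub>m (dim_row U))"

lemma mat_adjoint_index:
  assumes "i < dim_col A" "j < dim_row A"
  shows "mat_adjoint A $$ (i, j) = conjugate (A $$ (j, i))"
  using assms by (simp add: mat_adjoint_def mat_of_rows_index)

end

theory Submission
  imports Defs
begin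

text \<open>The eigenvalues of a circulant matrix \<open>U\<close> are the values \<open>u(\<omega>)\<close> of its symbol at the \<open>n\<close>-th roots
  of unity, and \<open>U\<^sup>m = 1\<close> makes each of them an \<open>m\<close>-th root of unity. Let \<open>D\<close> be a common denominator
  of the entries. For a prime \<open>q\<close> not dividing \<open>D m\<close>, the congruence \<open>f(X)\<^sup>q \<equiv> f(X\<^sup>q)\<close> modulo \<open>q\<close>
  in \<open>\<int>[X]\<close> gives \<open>u(\<omega>)\<^sup>q \<equiv> u(\<omega>\<^sup>q)\<close> modulo \<open>q\<close>, up to factors prime to \<open>q\<close>. Distinct \<open>m\<close>-th roots
  of unity are not congruent modulo \<open>q\<close>, so \<open>u(\<omega>)\<^sup>q = u(\<omega>\<^sup>q)\<close>, and hence \<open>u(\<omega>)\<^sup>k = u(\<omega>\<^sup>k)\<close> for every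
  \<open>k\<close> coprime to \<open>D m\<close>. Taking \<open>k = 1 + n t\<close> yields \<open>u(\<omega>)\<^bsup>n t\<^esup> = 1\<close> for many \<open>t\<close>, which bounds the
  order of \<open>u(\<omega>)\<^sup>n\<close>. This replaces the irreducibility of the cyclotomic polynomials.\<close>

section \<open>Powers and the Frobenius congruence modulo a prime\<close>

lemma power_mod_if_power_eq_one:
  fixes x :: "'a :: monoid_mult"
  assumes "x ^ n = 1"
  shows "x ^ (k mod n) = x ^ k"
proof -
  have "x ^ k = x ^ (n * (k div n) + k mod n)"
    by simp
  then show ?thesis
    by (simp only: power_add power_mult assms power_one mult_1_left)
qed

text \<open>The inner binomial coefficients are multiples of \<open>q\<close>. The ring is arbitrary
  because both integers and integer polynomials are needed.\<close>

lemma prime_dvd_power_add: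
  fixes x y :: "'a :: comm_ring_1"
  assumes "prime q"
  shows "of_nat q dvd (x + y) ^ q - x ^ q - y ^ q"
proof -
  have q: "q > 0"
    using assms by (simp add: prime_gt_0_nat)
  have split: "{..q} = insert 0 (insert q {0<..<q})"
    using q by auto
  have "(x + y) ^ q = y ^ q + (x ^ q + (\<Sum>k\<in>{0<..<q}. of_nat (q choose k) * x ^ k * y ^ (q - k)))"
    unfolding binomial_ring using q by (subst split) simp
  moreover have "of_nat q dvd (\<Sum>k\<in>{0<..<q}. of_nat (q choose k) * x ^ k * y ^ (q - k))"
  proof (intro dvd_sum dvd_mult2)
    fix k assume "k \<in> {0<..<q}"
    then have "q dvd (q choose k)"
      using assms by (intro dvd_choose_prime) auto
    then show "(of_nat q :: 'a) dvd of_nat (q choose k)"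
      by (auto simp: dvd_def)
  qed
  ultimately show ?thesis
    by simp
qed

lemma prime_dvd_int_power_diff:
  fixes a :: int
  assumes "prime q"
  shows "int q dvd a ^ q - a"
proof -
  \<comment> \<open>By the binomial congruence with \<open>y = 1\<close>, the residue of
    \<open>a ^ q - a\<close> modulo \<open>q\<close> does not change from \<open>a\<close> to
    \<open>a + 1\<close>; induction runs from 0 in both directions.\<close>
  have step: "int q dvd ((a + 1) ^ q - (a + 1)) - (a ^ q - a)" for a
    using prime_dvd_power_add[OF assms, of a 1] by (simp add: algebra_simps)
  show ?thesis
  proof (induction a rule: int_induct[where k = 0])
    case base
    then show ?case
      using assms by (simp add: prime_gt_0_nat power_0_left)
  next
    case (step1 i)
    then show ?case
      using dvd_add[OF step[of i] step1(2)] by (simp add: algebra_simps)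
  next
    case (step2 i)
    then show ?case
      using dvd_diff[OF step2(2) step[of "i - 1"]] by (simp add: algebra_simps)
  qed
qed

text \<open>Induction on a + X g: the \<open>q\<close>-th power splits modulo \<open>q\<close>,
  Fermat's little theorem handles the constant a, and (X g)^q - X^q g(X^q) = X^q (g^q -
  g(X^q)).\<close>

lemma prime_dvd_poly_power_diff:
  fixes f :: "int poly"
  assumes "prime q"
  shows "of_nat q dvd f ^ q - pcompose f (monom 1 q)"
proof (induction f)
  case 0
  then show ?case
    using assms by (simp add: prime_gt_0_nat power_0_left)
next
  case (pCons a f)
  have q: "q > 0"
    using assms by (simp add: prime_gt_0_nat)
  let ?X = "monom 1 1 :: int poly"
  have f: "pCons a f = [:a:] + ?X * f"
    by (simp add: monom_altdef)
  have "of_nat q dvd (pCons a f) ^ q - [:a:] ^ q - (?X * f) ^ q"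
    unfolding f by (rule prime_dvd_power_add[OF assms])
  moreover have "of_nat q dvd [:a:] ^ q - [:a:]"
  proof -
    obtain c where "a ^ q - a = int q * c"
      using prime_dvd_int_power_diff[OF assms, of a] by (auto simp: dvd_def)
    then have "[:a:] ^ q - [:a:] = of_nat q * [:c:]"
      by (simp add: of_nat_poly poly_const_pow)
    then show ?thesis
      by (metis dvd_triv_left)
  qed
  moreover have "of_nat q dvd monom 1 q * (f ^ q - pcompose f (monom 1 q))"
    using pCons.IH by (rule dvd_mult)
  ultimately have "of_nat q dvd ((pCons a f) ^ q - [:a:] ^ q - (?X * f) ^ q) + ([:a:] ^ q - [:a:])
      + monom 1 q * (f ^ q - pcompose f (monom 1 q))"
    by (intro dvd_add)
  also have "\<dots> = (pCons a f) ^ q - pcompose (pCons a f) (monom 1 q)"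
    by (simp add: pcompose_pCons algebra_simps power_mult_distrib monom_power)
  finally show ?case .
qed

section \<open>Algebraic integers and the ring Z[z]\<close>

text \<open>\<open>x\<close> is an eigenvalue of an integer matrix, hence a root of its
  characteristic polynomial, which is monic over the integers.\<close>

lemma algebraic_int_if_int_eigenvector:
  fixes x :: "'a :: field_char_0" and v :: "nat \<Rightarrow> 'a" and c :: "nat \<Rightarrow> nat \<Rightarrow> int"
  assumes eq: "\<And>i. i < L \<Longrightarrow> x * v i = (\<Sum>j<L. of_int (c i j) * v j)"
    and "k < L" "v k \<noteq> 0"
  shows "algebraic_int x"
proof -
  define C where "C = mat L L (\<lambda>(i, j). c i j)"
  define CC where "CC = map_mat (of_int :: int \<Rightarrow> 'a) C"
  have C: "C \<in> carrier_mat L L" and CC: "CC \<in> carrier_mat L L"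
    by (auto simp: C_def CC_def)
  have "eigenvector CC (vec L v) x"
    unfolding eigenvector_def
  proof (intro conjI)
    show "vec L v \<noteq> 0\<^sub>v (dim_row CC)"
      using assms(2,3) CC by (auto dest: arg_cong[where f = "\<lambda>w. w $ k"])
    show "CC *\<^sub>v vec L v = x \<cdot>\<^sub>v vec L v"
      by (rule eq_vecI) (auto simp: CC_def C_def scalar_prod_def eq atLeast0LessThan)
  qed (use CC in auto)
  then have "poly (char_poly CC) x = 0"
    using eigenvalue_root_char_poly[OF CC] unfolding eigenvalue_def by auto
  also have "char_poly CC = map_poly of_int (char_poly C)"
    unfolding CC_def using C by (rule of_int_hom.char_poly_hom)
  finally show ?thesis
    using degree_monic_char_poly[OF C] by (auto simp: algebraic_int_altdef_ipoly)
qed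

text \<open>Exponents of \<open>z\<close> matter only modulo \<open>L\<close>, so finitely many
  powers generate Z[z] as a group.\<close>

lemma ipoly_at_root_of_unity:
  fixes z :: "'a :: field_char_0" and p :: "int poly"
  assumes "z ^ L = 1" "L > 0"
  shows "\<exists>c :: nat \<Rightarrow> int. poly (map_poly of_int p) z = (\<Sum>j<L. of_int (c j) * z ^ j)"
proof -
  note z = power_mod_if_power_eq_one[OF assms(1)]
  have "poly (map_poly of_int p) z = (\<Sum>k\<le>degree p. of_int (coeff p k) * z ^ k)"
    by (simp add: poly_altdef)
  also have "\<dots> = (\<Sum>j<L. \<Sum>k | k \<in> {..degree p} \<and> k mod L = j. of_int (coeff p k) * z ^ k)"
    using assms by (intro sum.group[symmetric]) auto
  also have "\<dots> = (\<Sum>j<L. of_int (\<Sum>k | k \<in> {..degree p} \<and> k mod L = j. coeff p k) * z ^ j)"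
    (is "_ = (\<Sum>j<L. of_int (?c j) * _)")
    by (intro sum.cong refl) (auto simp: sum_distrib_right z intro!: sum.cong)
  finally show ?thesis
    by (rule exI[of _ ?c])
qed

text \<open>This is the ring Z[z], in which the congruences modulo \<open>q\<close> take
  place.\<close>

definition int_adjoin :: "'a :: field_char_0 \<Rightarrow> 'a set" where
  "int_adjoin z = range (\<lambda>p :: int poly. poly (map_poly of_int p) z)"

lemma int_adjoin_of_int: "of_int a \<in> int_adjoin z"
  unfolding int_adjoin_def by (rule range_eqI[of _ _ "[:a:]"]) (cases "a = 0"; simp add: map_poly_pCons)

lemma int_adjoin_self: "z \<in> int_adjoin z"
  unfolding int_adjoin_def by (rule range_eqI[of _ _ "[:0, 1:]"]) simp

lemma int_adjoin_add:
  assumes "x \<in> int_adjoin z" "y \<in> int_adjoin z"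
  shows "x + y \<in> int_adjoin z"
proof -
  obtain p r :: "int poly" where "x = poly (map_poly of_int p) z" "y = poly (map_poly of_int r) z"
    using assms by (auto simp: int_adjoin_def)
  then have "x + y = poly (map_poly of_int (p + r)) z"
    by (simp add: of_int_poly_hom.hom_add)
  then show ?thesis
    by (simp add: int_adjoin_def)
qed

lemma int_adjoin_mult:
  assumes "x \<in> int_adjoin z" "y \<in> int_adjoin z"
  shows "x * y \<in> int_adjoin z"
proof -
  obtain p r :: "int poly" where "x = poly (map_poly of_int p) z" "y = poly (map_poly of_int r) z"
    using assms by (auto simp: int_adjoin_def)
  then have "x * y = poly (map_poly of_int (p * r)) z"
    by (simp add: of_int_poly_hom.hom_mult)
  then show ?thesis
    by (simp add: int_adjoin_def)
qed

lemma int_adjoin_diff: "x \<in> int_adjoin z \<Longrightarrow> y \<in> int_adjoin z \<Longrightarrow> x - y \<in> int_adjoin z"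
  using int_adjoin_add[of x z "of_int (-1) * y"] int_adjoin_mult[of "of_int (-1)" z y]
    int_adjoin_of_int[of "-1" z]
  by simp

lemma int_adjoin_power: "x \<in> int_adjoin z \<Longrightarrow> x ^ k \<in> int_adjoin z"
  using int_adjoin_of_int[of 1 z] by (induction k) (auto intro: int_adjoin_mult)

lemma int_adjoin_sum: "(\<And>i. i \<in> I \<Longrightarrow> f i \<in> int_adjoin z) \<Longrightarrow> sum f I \<in> int_adjoin z"
  using int_adjoin_of_int[of 0 z] by (induction I rule: infinite_finite_induct) (auto intro: int_adjoin_add)

lemma int_adjoin_poly:
  "x \<in> int_adjoin z \<Longrightarrow> poly (map_poly of_int p) x \<in> int_adjoin z"
  by (induction p)
    (use int_adjoin_of_int[of 0 z] in
      \<open>auto simp: map_poly_pCons intro!: int_adjoin_add int_adjoin_mult int_adjoin_of_int\<close>)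

text \<open>Multiplication by \<open>x\<close> acts on the generators \<open>z ^ i\<close>,
  \<open>i < L\<close>, through an integer matrix. Their vector is an eigenvector, nonzero since its
  entry at 0 is 1.\<close>

lemma algebraic_int_int_adjoin:
  assumes "z ^ L = 1" "L > 0" "x \<in> int_adjoin z"
  shows "algebraic_int x"
proof -
  have "\<exists>c :: nat \<Rightarrow> int. x * z ^ i = (\<Sum>j<L. of_int (c j) * z ^ j)" for i
  proof -
    have "x * z ^ i \<in> int_adjoin z"
      using assms by (intro int_adjoin_mult int_adjoin_power int_adjoin_self)
    then show ?thesis
      using ipoly_at_root_of_unity[OF assms(1,2)] by (auto simp: int_adjoin_def)
  qed
  then obtain c :: "nat \<Rightarrow> nat \<Rightarrow> int"
    where "\<And>i. x * z ^ i = (\<Sum>j<L. of_int (c i j) * z ^ j)"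
    by metis
  then show ?thesis
    using assms(2) by (intro algebraic_int_if_int_eigenvector[of L x "\<lambda>i. z ^ i" c 0]) auto
qed

text \<open>For nonzero \<open>b\<close> the quotient is rational and an algebraic integer, hence an
  integer: divisibility in Z[z] descends to the integers.\<close>

lemma dvd_if_of_int_eq_mult_int_adjoin:
  fixes z :: "'a :: field_char_0"
  assumes "z ^ L = 1" "L > 0" "r \<in> int_adjoin z" "of_int a = of_int b * r"
  shows "b dvd a"
proof (cases "b = 0")
  case True
  then show ?thesis using assms by simp
next
  case False
  then have r: "r = of_int a / of_int b"
    using assms by (simp add: field_simps)
  then have "r \<in> \<int>"
    using rational_algebraic_int_is_int[OF algebraic_int_int_adjoin[OF assms(1-3)]] by simp
  then obtain k where "r = of_int k"
    by (auto elim: Ints_cases)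
  then have "(of_int a :: 'a) = of_int (b * k)"
    using assms by simp
  then show ?thesis
    by (simp only: of_int_eq_iff) simp
qed

text \<open>Since the powers of \<open>x\<close> sum to 0, \<open>m\<close> is the sum of the 1 -
  x^i, each a multiple of 1 - x. Applied to quotients, this keeps distinct \<open>m\<close>-th roots
  of unity apart modulo primes not dividing \<open>m\<close>.\<close>

lemma one_minus_root_of_unity_dvd:
  fixes x :: "'a :: field_char_0"
  assumes "x ^ m = 1" "x \<noteq> 1" "x \<in> int_adjoin z"
  shows "\<exists>w \<in> int_adjoin z. of_nat m = (1 - x) * w"
proof -
  have "(1 - x) * (\<Sum>i<m. x ^ i) = 0"
    using assms by (simp flip: one_diff_power_eq)
  then have s: "(\<Sum>i<m. x ^ i) = 0"
    using assms by simp
  have "of_nat m = (\<Sum>i<m. 1 - x ^ i)"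
    by (simp add: sum_subtractf s)
  also have "\<dots> = (1 - x) * (\<Sum>i<m. \<Sum>j<i. x ^ j)"
    by (simp add: one_diff_power_eq sum_distrib_left)
  finally show ?thesis
    using assms by (blast intro: int_adjoin_sum int_adjoin_power)
qed

section \<open>Frobenius on values at roots of unity\<close>

text \<open>If \<open>s ^ q\<close> and \<open>t\<close> differed, their quotient \<open>x\<close>
  would make \<open>q\<close> divide D (x - 1) in Z[z], while 1 - x divides \<open>m\<close>; then
  \<open>q\<close> would divide \<open>D * m\<close>.\<close>

lemma frobenius_prime:
  fixes \<omega> s t :: complex and f :: "int poly" and D :: int
  assumes "prime q" "\<not> int q dvd D * int m" "n > 0" "m > 0"
    and "\<omega> ^ n = 1" "s ^ m = 1" "t ^ m = 1"
    and s: "poly (map_poly of_int f) \<omega> = of_int D * s"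
    and t: "poly (map_poly of_int f) (\<omega> ^ q) = of_int D * t"
  shows "s ^ q = t"
proof (rule ccontr)
  assume neq: "s ^ q \<noteq> t"
  \<comment> \<open>A primitive root of unity of order \<open>n * m\<close>, so that
    \<open>\<omega>\<close>, \<open>s\<close> and \<open>t\<close> are all powers of it.\<close>
  define z where "z = cis (2 * pi / real (n * m))"
  have nm: "n * m > 0"
    using assms by simp
  have z: "z ^ (n * m) = 1"
    using nm unfolding z_def DeMoivre by simp
  have root: "x \<in> int_adjoin z" if "x ^ (n * m) = 1" for x
  proof -
    have "x \<in> (\<lambda>k. cis (2 * pi * real k / real (n * m))) ` {..<n * m}"
      using bij_betw_imp_surj_on[OF bij_betw_roots_unity[OF nm]] that by simp
    then obtain k where "x = cis (2 * pi * real k / real (n * m))"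
      by blast
    then have "x = z ^ k"
      by (simp add: z_def DeMoivre mult_ac)
    then show ?thesis
      by (simp add: int_adjoin_power int_adjoin_self)
  qed
  have \<omega>z: "\<omega> \<in> int_adjoin z" and sz: "s \<in> int_adjoin z" and tz: "t \<in> int_adjoin z"
    using assms by (auto intro!: root simp: power_mult) (metis mult.commute power_mult power_one)+
  obtain h where h: "f ^ q - pcompose f (monom 1 q) = of_nat q * h"
    using prime_dvd_poly_power_diff[OF \<open>prime q\<close>] by (auto simp: dvd_def)
  define H where "H = poly (map_poly of_int h) \<omega>"
  have "poly (map_poly of_int (f ^ q - pcompose f (monom 1 q))) \<omega> = of_nat q * H"
    unfolding h H_def by (simp add: of_int_poly_hom.hom_mult of_int_poly_hom.hom_of_nat poly_of_nat)
  then have H: "of_int D ^ q * s ^ q - of_int D * t = of_nat q * H"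
    using s t by (simp add: of_int_poly_hom.hom_minus of_int_poly_hom.hom_power of_int_hom.map_poly_pcompose
        map_poly_monom poly_pcompose poly_monom power_mult_distrib)
  \<comment> \<open>Modulo \<open>q\<close>, \<open>D ^ q\<close> may be replaced by
    \<open>D\<close>, which then factors out of the difference.\<close>
  obtain e where e: "D ^ q - D = int q * e"
    using prime_dvd_int_power_diff[OF \<open>prime q\<close>] by (auto simp: dvd_def)
  then have e': "of_int D ^ q = (of_int D + of_nat q * of_int e :: complex)"
    by (metis add.commute diff_add_cancel of_int_add of_int_mult of_int_of_nat_eq of_int_power)
  \<comment> \<open>The power \<open>t ^ (m - 1)\<close> is the inverse of \<open>t\<close>.\<close>
  define x where "x = s ^ q * t ^ (m - 1)"
  have t1: "t * t ^ (m - 1) = 1"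
    using assms by (simp flip: power_Suc)
  have "x \<noteq> 1"
    using neq t1 unfolding x_def by (metis mult.commute mult.left_commute mult.right_neutral)
  moreover have "x ^ m = 1"
    using assms unfolding x_def by (metis mult.commute mult_1 power_mult power_mult_distrib power_one)
  moreover have xz: "x \<in> int_adjoin z"
    unfolding x_def by (intro int_adjoin_mult int_adjoin_power sz tz)
  ultimately obtain w where w: "w \<in> int_adjoin z" "of_nat m = (1 - x) * w"
    using one_minus_root_of_unity_dvd by blast
  have "of_int D * (s ^ q - t) = of_nat q * (H - of_int e * s ^ q)"
    using H unfolding e' by (simp add: algebra_simps)
  then have Dx: "of_int D * (x - 1) = of_nat q * ((H - of_int e * s ^ q) * t ^ (m - 1))"
  proof -
    have "of_int D * (x - 1) = of_int D * (s ^ q - t) * t ^ (m - 1)"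
      unfolding x_def using t1 by (simp add: algebra_simps)
    then show ?thesis
      using \<open>of_int D * (s ^ q - t) = _\<close> by (simp only: mult.assoc)
  qed
  have "of_int (D * int m) = - (of_int D * (x - 1)) * w"
    by (simp add: w(2) algebra_simps)
  also have "\<dots> = of_int (int q) * (of_int (-1) * ((H - of_int e * s ^ q) * t ^ (m - 1) * w))"
    unfolding Dx by simp
  finally have "of_int (D * int m) =
      of_int (int q) * (of_int (-1) * ((H - of_int e * s ^ q) * t ^ (m - 1) * w))" .
  moreover have "of_int (-1) * ((H - of_int e * s ^ q) * t ^ (m - 1) * w) \<in> int_adjoin z"
    unfolding H_def
    by (intro int_adjoin_mult int_adjoin_diff int_adjoin_power int_adjoin_poly int_adjoin_of_int sz tz \<omega>z w)
  ultimately have "int q dvd D * int m"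
    using z nm by (intro dvd_if_of_int_eq_mult_int_adjoin)
  then show False
    using assms by simp
qed


text \<open>Induction over prime factors: a prime \<open>p\<close> moves \<open>\<omega>\<close> to
  \<open>\<omega> ^ p\<close>, and the remaining factor is treated there. Hence the hypotheses on
  \<open>l\<close> cover all \<open>n\<close>-th roots of unity.\<close>

lemma frobenius_coprime:
  fixes f :: "int poly" and D :: nat and l :: "complex \<Rightarrow> complex"
  assumes "n > 0" "m > 0"
    and l: "\<And>\<omega>. \<omega> ^ n = 1 \<Longrightarrow> l \<omega> ^ m = 1"
    and f: "\<And>\<omega>. \<omega> ^ n = 1 \<Longrightarrow> poly (map_poly of_int f) \<omega> = of_nat D * l \<omega>"
    and "k > 0" "coprime k (D * m)" "\<omega> ^ n = 1"
  shows "l \<omega> ^ k = l (\<omega> ^ k)"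
  using assms(5-)
proof (induction k arbitrary: \<omega> rule: prime_divisors_induct)
  case (factor p k)
  have root: "(\<omega> ^ p) ^ n = 1"
    using factor.prems by (metis power_mult mult.commute power_one)
  have "\<not> p dvd D * m"
    using factor by (metis coprime_common_divisor dvd_triv_left not_prime_unit)
  then have "\<not> int p dvd int D * int m"
    by (metis int_dvd_int_iff of_nat_mult)
  then have "l \<omega> ^ p = l (\<omega> ^ p)"
    using factor root assms(1,2) l f by (intro frobenius_prime[of p "int D" m n \<omega> _ _ f]) auto
  moreover have "l (\<omega> ^ p) ^ k = l ((\<omega> ^ p) ^ k)"
    using factor root by (intro factor.IH) (auto simp: coprime_mult_left_iff)
  ultimately show ?case
    by (simp add: power_mult)
qed auto

section \<open>Orders and exponents from an arithmetic progression\<close>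

lemma power_eq_one_iff_order_dvd:
  fixes x :: "'a :: field"
  assumes "x ^ M = 1" "M > 0"
  obtains d where "d > 0" "\<And>t. x ^ t = 1 \<longleftrightarrow> d dvd t"
proof -
  define d where "d = (LEAST d. d > 0 \<and> x ^ d = 1)"
  have d: "d > 0 \<and> x ^ d = 1"
    unfolding d_def by (rule LeastI[of _ M]) (use assms in simp)
  have le: "d \<le> e" if "e > 0" "x ^ e = 1" for e
    unfolding d_def by (rule Least_le) (use that in simp)
  have "x ^ t = 1 \<longleftrightarrow> d dvd t" for t
  proof -
    have "x ^ t = x ^ (t mod d)"
      using d by (simp add: power_mod_if_power_eq_one)
    then show ?thesis
      using le[of "t mod d"] d mod_less_divisor[of d t]
      by (metis dvd_eq_mod_eq_0 gr0I leD power_0)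
  qed
  with d that show thesis
    by blast
qed

text \<open>For a prime \<open>p\<close> dividing the order \<open>d\<close>, the exponents tested
  are the prime-to-\<open>p\<close> part of \<open>M\<close> times 1 or 2. They leave only
  \<open>p = 2\<close>, to the first power and with \<open>n\<close> odd.\<close>

lemma power_eq_one_if_coprime_progression:
  fixes x :: "'a :: field" and n M :: nat
  assumes "x ^ M = 1" "M > 0"
    and prog: "\<And>t. coprime (1 + n * t) M \<Longrightarrow> x ^ t = 1"
  shows "x ^ 2 = 1" "even n \<Longrightarrow> x = 1"
proof -
  obtain d where "d > 0" and d: "\<And>t. x ^ t = 1 \<longleftrightarrow> d dvd t"
    using power_eq_one_iff_order_dvd[OF assms(1,2)] by blast
  \<comment> \<open>For t = M' u, the number 1 + n t is automatically coprime to \<open>M'\<close>,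
    so only \<open>p\<close> can obstruct.\<close>
  have part: "\<exists>M'. \<not> p dvd M' \<and> (\<forall>u. \<not> p dvd 1 + n * (M' * u) \<longrightarrow> d dvd M' * u)"
    if p: "prime p" for p
  proof -
    obtain M' where M': "M = p ^ multiplicity p M * M'" "\<not> p dvd M'"
      using multiplicity_decompose'[of M p] assms(2) not_prime_unit[of p] p by blast
    have "d dvd M' * u" if u: "\<not> p dvd 1 + n * (M' * u)" for u
    proof -
      have "coprime (1 + n * (M' * u)) M'"
      proof (rule coprimeI)
        fix c assume "c dvd 1 + n * (M' * u)" "c dvd M'"
        moreover from this have "c dvd n * (M' * u)"
          by simp
        ultimately show "c dvd 1"
          using dvd_add_left_iff by blast
      qed
      moreover have "coprime (1 + n * (M' * u)) (p ^ multiplicity p M)"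
        using prime_imp_coprime[OF p u] by (simp add: coprime_commute)
      ultimately have "coprime (1 + n * (M' * u)) M"
        by (subst M'(1)) simp
      then show ?thesis
        using prog d by blast
    qed
    with M' show ?thesis by blast
  qed
  have two: "p = 2 \<and> odd n" if p: "prime p" "p dvd d" for p
  proof -
    obtain M' where M': "\<not> p dvd M'" "\<And>u. \<not> p dvd 1 + n * (M' * u) \<Longrightarrow> d dvd M' * u"
      using part[OF p(1)] by blast
    \<comment> \<open>Read contrapositively: \<open>p\<close> divides 1 + n M' u for every
      \<open>u\<close> prime to \<open>p\<close>, in particular for 1 and, if \<open>p\<close> is
      odd, for 2.\<close>
    have u: "p dvd u" if "\<not> p dvd 1 + n * (M' * u)" for u
      using M' that p by (metis dvd_trans prime_dvd_mult_iff)
    have p1: "\<not> p dvd 1"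
      using p by (simp add: prime_nat_iff)
    then have 1: "p dvd 1 + n * M'"
      using u[of 1] by auto
    then have "\<not> p dvd n"
      using p1 by (metis dvd_add_left_iff dvd_mult2)
    moreover have "p = 2"
    proof (rule ccontr)
      assume "p \<noteq> 2"
      then have "\<not> p dvd 2"
        using p primes_dvd_imp_eq two_is_prime_nat by blast
      then have "p dvd 1 + n * (M' * 2)"
        using u[of 2] by auto
      moreover have "p dvd 2 * (1 + n * M')"
        using 1 by (rule dvd_mult)
      \<comment> \<open>This difference equals 1.\<close>
      ultimately have "p dvd 2 * (1 + n * M') - (1 + n * (M' * 2))"
        by (rule dvd_diff_nat[rotated])
      then show False
        using p1 by simp
    qed
    ultimately show ?thesis by simp
  qed
  have four: "\<not> 4 dvd d"
  proof
    assume "4 dvd d"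
    obtain M' where M': "odd M'" "\<And>u. odd (1 + n * (M' * u)) \<Longrightarrow> d dvd M' * u"
      using part[OF two_is_prime_nat] by blast
    \<comment> \<open>With \<open>u = 2\<close> the number 1 + 2 n M' is odd whatever
      \<open>n\<close> is.\<close>
    from M'(2)[of 2] have "d dvd M' * 2"
      by simp
    with \<open>4 dvd d\<close> have "2 * 2 dvd M' * 2"
      by (metis dvd_trans mult_2 numeral_Bit0)
    then show False
      using M'(1) by simp
  qed
  have "d dvd 2"
  proof (cases "even d")
    case True
    then obtain e where e: "d = 2 * e" by blast
    have "e = 1"
    proof (rule ccontr)
      assume "e \<noteq> 1"
      then obtain p where p: "prime p" "p dvd e"
        using prime_factor_nat by blast
      then have "p = 2"
        using two e by auto
      then show False
        using p four e by auto
    qed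
    then show ?thesis
      using e by simp
  next
    case False
    then have "d = 1"
      using two prime_factor_nat by metis
    then show ?thesis by simp
  qed
  then show "x ^ 2 = 1"
    using d by blast
  assume "even n"
  then have "d = 1"
    using two prime_factor_nat by metis
  then show "x = 1"
    using d[of 1] by simp
qed

section \<open>Common denominators, and circulant matrices with their symbols\<close>

lemma common_denominator:
  fixes a :: "nat \<Rightarrow> 'a :: field_char_0"
  assumes "\<And>i. i < n \<Longrightarrow> a i \<in> \<rat>"
  shows "\<exists>D > 0. \<forall>i<n. \<exists>c :: int. of_nat D * a i = of_int c"
  using assms
proof (induction n)
  case (Suc n)
  then obtain D where D: "D > 0" "\<And>i. i < n \<Longrightarrow> \<exists>c :: int. of_nat D * a i = of_int c"
    by (metis less_Suc_eq)
  obtain p q :: int where pq: "q > 0" "a n = of_int p / of_int q"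
    using Suc.prems[of n] by (auto elim: Rats_cases')
  have "\<exists>c :: int. of_nat (nat q * D) * a i = of_int c" if i: "i < Suc n" for i
  proof (cases "i = n")
    case True
    have "of_nat (nat q * D) * a i = of_int (int D * p)"
      using pq True by simp
    then show ?thesis ..
  next
    case False
    then obtain c :: int where c: "of_nat D * a i = of_int c"
      using D(2)[of i] i by auto
    have "of_nat (nat q * D) * a i = of_int (q * c)"
      using pq c by (simp add: mult.assoc)
    then show ?thesis ..
  qed
  then show ?case
    using D pq by (intro exI[of _ "nat q * D"]) simp
qed auto

text \<open>Entries depend on i - j, so column 0 lists the defining vector in its own order.\<close>

definition circulant_symbol :: "'a :: comm_ring_1 mat \<Rightarrow> 'a \<Rightarrow> 'a" where
  "circulant_symbol U \<omega> = (\<Sum>i<dim_row U. \<omega> ^ i * U $$ (i, 0))"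

text \<open>Substituting l = i - j modulo \<open>n\<close> turns the entry into that at (l, 0) and
  \<open>\<omega> ^ i\<close> into \<open>\<omega> ^ l * \<omega> ^ j\<close>.\<close>

lemma circulant_left_eigenvector:
  fixes U :: "'a :: comm_ring_1 mat"
  assumes "circulant_mat n U" "\<omega> ^ n = 1" "j < n"
  shows "(\<Sum>i<n. \<omega> ^ i * U $$ (i, j)) = circulant_symbol U \<omega> * \<omega> ^ j"
proof -
  obtain a where U: "U \<in> carrier_mat n n"
    and a: "\<And>i j. i < n \<Longrightarrow> j < n \<Longrightarrow> U $$ (i, j) = a $ nat ((int i - int j) mod int n)"
    using assms(1) unfolding circulant_mat_def by blast
  have shift: "(nat ((int i - int j) mod int n) + j) mod n = i" if "i < n" for i
  proof -
    have "int ((nat ((int i - int j) mod int n) + j) mod n) = ((int i - int j) mod int n + int j) mod int n"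
      using assms(3) by (simp add: zmod_int)
    also have "\<dots> = int i"
      using that by (simp add: mod_add_left_eq)
    finally show ?thesis by simp
  qed
  have unshift: "nat ((int ((l + j) mod n) - int j) mod int n) = l" if "l < n" for l
    using that by (simp add: zmod_int mod_diff_left_eq)
  have "(\<Sum>i<n. \<omega> ^ i * U $$ (i, j)) = (\<Sum>l<n. \<omega> ^ (l + j) * U $$ (l, 0))"
  proof (rule sum.reindex_bij_witness[of _ "\<lambda>l. (l + j) mod n" "\<lambda>i. nat ((int i - int j) mod int n)"])
    fix i assume "i \<in> {..<n}"
    then have i: "i < n" by simp
    let ?l = "nat ((int i - int j) mod int n)"
    have l: "?l < n"
      using assms(3) by (simp add: nat_less_iff)
    show "(?l + j) mod n = i" "?l \<in> {..<n}"
      using shift i l by auto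
    have "U $$ (?l, 0) = U $$ (i, j)"
      using a[of i j] a[of ?l 0] i l assms(3) by simp
    then show "\<omega> ^ (?l + j) * U $$ (?l, 0) = \<omega> ^ i * U $$ (i, j)"
      using power_mod_if_power_eq_one[OF assms(2), of "?l + j"] shift[OF i] by simp
  qed (use unshift assms(3) in auto)
  also have "\<dots> = circulant_symbol U \<omega> * \<omega> ^ j"
    using U by (simp add: circulant_symbol_def power_add sum_distrib_left sum_distrib_right mult_ac)
  finally show ?thesis .
qed

text \<open>The width \<open>k\<close> is free because \<open>V\<close> will be a power of
  \<open>U\<close> in one use and a single column in another.\<close>

lemma circulant_left_eigenvector_mult:
  fixes U V :: "'a :: comm_ring_1 mat"
  assumes "circulant_mat n U" "\<omega> ^ n = 1" "V \<in> carrier_mat n k" "j < k"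
  shows "(\<Sum>i<n. \<omega> ^ i * (U * V) $$ (i, j)) = circulant_symbol U \<omega> * (\<Sum>i<n. \<omega> ^ i * V $$ (i, j))"
proof -
  have U: "U \<in> carrier_mat n n"
    using assms(1) by (simp add: circulant_mat_def)
  have "(\<Sum>i<n. \<omega> ^ i * (U * V) $$ (i, j)) = (\<Sum>i<n. \<Sum>l<n. \<omega> ^ i * U $$ (i, l) * V $$ (l, j))"
    using U assms by (simp add: scalar_prod_def sum_distrib_left atLeast0LessThan mult.assoc)
  also have "\<dots> = (\<Sum>l<n. (\<Sum>i<n. \<omega> ^ i * U $$ (i, l)) * V $$ (l, j))"
    by (subst sum.swap) (simp add: sum_distrib_right)
  also have "\<dots> = circulant_symbol U \<omega> * (\<Sum>i<n. \<omega> ^ i * V $$ (i, j))"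
    using assms by (simp add: circulant_left_eigenvector sum_distrib_left mult.assoc)
  finally show ?thesis .
qed

lemma circulant_symbol_power:
  fixes U :: "'a :: comm_ring_1 mat"
  assumes "circulant_mat n U" "\<omega> ^ n = 1" "j < n"
  shows "(\<Sum>i<n. \<omega> ^ i * (U ^\<^sub>m m) $$ (i, j)) = circulant_symbol U \<omega> ^ m * \<omega> ^ j"
proof (induction m)
  case 0
  have "U \<in> carrier_mat n n"
    using assms(1) by (simp add: circulant_mat_def)
  then show ?case
    using assms(3) by (simp add: if_distrib[of "(*) _"] cong: if_cong)
next
  case (Suc m)
  have U: "U \<in> carrier_mat n n"
    using assms(1) by (simp add: circulant_mat_def)
  \<comment> \<open>\<open>pow_mat\<close> appends the new factor on the right, whereas the left
    eigenvector acts on the leftmost one.\<close>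
  have "U ^\<^sub>m k * U = U * U ^\<^sub>m k" for k
    by (induction k) (use U in \<open>auto simp: assoc_mult_mat[of _ n n _ n _ n]\<close>)
  then have "U ^\<^sub>m Suc m = U * U ^\<^sub>m m"
    by simp
  then show ?case
    using Suc assms U
    by (simp add: circulant_left_eigenvector_mult[where k = n] mult.assoc del: index_mult_mat pow_mat.simps)
qed

text \<open>Let \<open>p\<close> have the entries of an eigenvector as coefficients. Pairing with
  the left eigenvector at \<open>\<omega>\<close> gives equal multiples \<open>\<xi>\<close> and
  u(\<omega>) of p(\<omega>). A nonzero \<open>p\<close> of degree below \<open>n\<close> cannot
  vanish at all \<open>n\<close> roots of unity.\<close>

lemma circulant_eigenvalue:
  fixes U :: "complex mat"
  assumes "circulant_mat n U" "eigenvalue U \<xi>"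
  shows "\<exists>\<omega>. \<omega> ^ n = 1 \<and> \<xi> = circulant_symbol U \<omega>"
proof -
  have U: "U \<in> carrier_mat n n"
    using assms(1) by (simp add: circulant_mat_def)
  obtain v where v: "v \<in> carrier_vec n" "v \<noteq> 0\<^sub>v n" "U *\<^sub>v v = \<xi> \<cdot>\<^sub>v v"
    using assms(2) U by (auto simp: eigenvalue_def eigenvector_def)
  define p where "p = (\<Sum>i<n. monom (v $ i) i)"
  have coeff: "coeff p i = (if i < n then v $ i else 0)" for i
    by (simp add: p_def coeff_sum)
  have "p \<noteq> 0"
  proof
    assume "p = 0"
    then have "v $ i = 0" if "i < n" for i
      using coeff[of i] that by simp
    then show False
      using v by auto
  qed
  moreover from this have "degree p < n"
    using coeff[of "degree p"] by (metis leading_coeff_0_iff)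
  ultimately have "card {x. poly p x = 0} < n"
    using card_poly_roots_bound[of p] by linarith
  moreover have "finite {x. poly p x = 0}"
    using \<open>p \<noteq> 0\<close> by (rule poly_roots_finite)
  moreover have "card {x :: complex. x ^ n = 1} = n"
    using \<open>degree p < n\<close> by (intro card_roots_unity_eq) simp
  ultimately have "\<not> {x. x ^ n = 1} \<subseteq> {x. poly p x = 0}"
    using card_mono by (metis leD)
  then obtain \<omega> where \<omega>: "\<omega> ^ n = 1" "poly p \<omega> \<noteq> 0"
    by auto
  have poly: "poly p x = (\<Sum>i<n. x ^ i * v $ i)" for x
    by (simp add: p_def poly_sum poly_monom mult.commute)
  define V where "V = mat_of_cols n [v]"
  have V: "V \<in> carrier_mat n 1" "\<And>i. i < n \<Longrightarrow> V $$ (i, 0) = v $ i"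
    by (auto simp: V_def mat_of_cols_index)
  have UV: "(U * V) $$ (i, 0) = \<xi> * v $ i" if "i < n" for i
  proof -
    have "(U * V) $$ (i, 0) = (U *\<^sub>v v) $ i"
      using U V(1) v(1) that by (simp add: V_def)
    also have "\<dots> = (\<xi> \<cdot>\<^sub>v v) $ i"
      by (simp only: v(3))
    finally show ?thesis
      using v(1) that by simp
  qed
  have "(\<Sum>i<n. \<omega> ^ i * (U * V) $$ (i, 0)) = circulant_symbol U \<omega> * (\<Sum>i<n. \<omega> ^ i * V $$ (i, 0))"
    using assms \<omega> V by (intro circulant_left_eigenvector_mult) auto
  then have "\<xi> * poly p \<omega> = circulant_symbol U \<omega> * poly p \<omega>"
    by (simp add: UV V poly sum_distrib_left mult_ac)
  then show ?thesis
    using \<omega> by auto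
qed

theorem theorem1:
  fixes n :: nat and U :: "complex mat"
  assumes "n \<ge> 1"
    and "spectral_unit n U"
    and "finite_order_mat U"
  shows "(even n \<longrightarrow> (\<forall>\<xi>. eigenvalue U \<xi> \<longrightarrow> \<xi> ^ n = 1)) \<and>
         (odd n \<longrightarrow> (\<forall>\<xi>. eigenvalue U \<xi> \<longrightarrow>
            \<xi> ^ n = 1 \<or> (\<exists>\<zeta>. \<zeta> ^ n = 1 \<and> \<xi> = - \<zeta>)))"
proof -
  have circ: "circulant_mat n U" and rat: "elements_mat U \<subseteq> \<rat>"
    using assms(2) by (auto simp: spectral_unit_def)
  have U: "U \<in> carrier_mat n n"
    using circ by (simp add: circulant_mat_def)
  have n: "n > 0"
    using assms(1) by simp
  obtain m where m: "m > 0" "U ^\<^sub>m m = 1\<^sub>m n"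
    using assms(3) U unfolding finite_order_mat_def by (metis carrier_matD(1) less_eq_Suc_le One_nat_def)
  let ?l = "circulant_symbol U"
  have root: "?l \<omega> ^ m = 1" if "\<omega> ^ n = 1" for \<omega>
    using circulant_symbol_power[OF circ that n, of m] m(2) n
    by (simp add: if_distrib[of "(*) _"] cong: if_cong)
  have "U $$ (i, 0) \<in> \<rat>" if "i < n" for i
    using rat U n that elements_matI[of U n n i 0] by auto
  then obtain D where "D > 0" and "\<forall>i<n. \<exists>c :: int. of_nat D * U $$ (i, 0) = of_int c"
    using common_denominator[of n "\<lambda>i. U $$ (i, 0)"] by blast
  then obtain c :: "nat \<Rightarrow> int" where c: "\<And>i. i < n \<Longrightarrow> of_nat D * U $$ (i, 0) = of_int (c i)"
    by metis
  \<comment> \<open>The symbol multiplied by \<open>D\<close>, now with integer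
    coefficients.\<close>
  define f where "f = (\<Sum>i<n. monom (c i) i)"
  have f: "poly (map_poly of_int f) \<omega> = of_nat D * ?l \<omega>" for \<omega>
  proof -
    have "poly (map_poly of_int f) \<omega> = (\<Sum>i<n. of_int (c i) * \<omega> ^ i)"
      by (simp add: f_def of_int_poly_hom.hom_sum map_poly_monom poly_sum poly_monom)
    also have "\<dots> = of_nat D * ?l \<omega>"
      using U by (simp add: circulant_symbol_def sum_distrib_left mult_ac flip: c)
    finally show ?thesis .
  qed
  have ev: "(\<xi> ^ n) ^ 2 = 1 \<and> (even n \<longrightarrow> \<xi> ^ n = 1)" if \<xi>: "eigenvalue U \<xi>" for \<xi>
  proof -
    obtain \<omega> where \<omega>: "\<omega> ^ n = 1" "\<xi> = ?l \<omega>"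
      using circulant_eigenvalue[OF circ \<xi>] by blast
    have \<xi>m: "\<xi> ^ m = 1"
      using root \<omega> by simp
    then have "\<xi> \<noteq> 0"
      using m(1) by (auto simp: power_0_left)
    have prog: "(\<xi> ^ n) ^ t = 1" if "coprime (1 + n * t) (D * m)" for t
    proof -
      have "\<xi> ^ (1 + n * t) = ?l (\<omega> ^ (1 + n * t))"
        unfolding \<omega>(2) using n m root f that \<omega> by (intro frobenius_coprime[of n m _ f D]) auto
      \<comment> \<open>The exponent 1 + n t fixes \<open>\<omega>\<close>, hence also
        \<open>\<xi>\<close>, which may be cancelled.\<close>
      also have "\<omega> ^ (1 + n * t) = \<omega>"
        using \<omega> by (simp add: power_mult)
      finally show ?thesis
        using \<open>\<xi> \<noteq> 0\<close> \<omega>(2) by (simp add: power_mult)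
    qed
    have "(\<xi> ^ n) ^ (D * m) = 1"
      using \<xi>m by (metis mult.commute power_mult power_one)
    then show ?thesis
      using power_eq_one_if_coprime_progression[of "\<xi> ^ n" "D * m" n] prog \<open>D > 0\<close> m(1) by auto
  qed
  have "\<xi> ^ n = 1 \<or> (\<exists>\<zeta>. \<zeta> ^ n = 1 \<and> \<xi> = - \<zeta>)" if "odd n" "eigenvalue U \<xi>" for \<xi>
  proof -
    have "\<xi> ^ n = 1 \<or> \<xi> ^ n = - 1"
      using ev[OF that(2)] by (simp add: power2_eq_1_iff)
    \<comment> \<open>If \<xi>^n = -1, the witness is -\<xi>, since \<open>n\<close> is odd.\<close>
    then show ?thesis
      using that(1) by (auto intro!: exI[of _ "- \<xi>"])
  qed
  then show ?thesis
    using ev by blast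
qed

end
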